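(* In executing the global search over a single coordinate $r$, that is, as the arrival time $x$ of user $r$ increases from $\underline a$ to $\overline a$ while the arrival times $a_j\in[\underline a,\overline a]$, $j\ne r$, of all other users are held fixed, the total number of breakpoints (of types 1a, 1b, 2a and 2b as defined in the context) is $O(N^3)$, i.e. bounded by $CN^3$ with a constant $C$ independent of $N$ and of all other problem data.
   Context: $N\ge1$ is an integer, $\mathcal N=\{1,\dots,N\}$, and $\alpha,\beta>0$ satisfy $N<\beta/\alpha+1$. For an arrival vector $\mathbf a\in\mathbb R^N$ (not necessarily ordered), the departure vector $\mathbf d(\mathbf a)$ is the unique $\mathbf d$ with $a_i\le d_i$ satisfying $$1=\int_{a_i}^{d_i}\Big[\beta-\alpha\Big(\sum_{j=1}^N \mathbf 1\{t\in[a_j,d_j]\}-1\Big)\Big]dt,\qquad i\in\mathcal N.$$ Given $d_1^*\le\dots\le d_N^*$, put $\underline a=d_1^*-\frac{N}{\beta-\alpha(N-1)}$, $\overline a=d_N^*+\frac{N}{\beta-\alpha(N-1)}$. Fix $r\in\mathcal N$ and $a_j\in[\underline a,\overline a]$ for $j\neq r$. For $x\in[\underline a,\overline a]$ let $A_r(x)=x$, $A_j(x)=a_j$ ($j\ne r$), and let $D_i(x)$ be the departure time of user $i$ for the arrival vector $(A_1(x),\dots,A_N(x))$; each $D_i$ is a continuous piecewise affine function of $x$. A departure $D_i$ is said to overtake an arrival $A_j$ at $x_0$ if $D_i<A_j$ immediately to the left of $x_0$ and $D_i(x_0)\ge A_j(x_0)$; it is said to be overtaken by $A_j$ at $x_0$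 if $D_i(x_0)\ge A_j(x_0)$ and $D_i<A_j$ immediately to the right of $x_0$. A breakpoint is one of the following events at some value of $x$, each event counted separately: type 1a: the arrival of $r$ overtakes the arrival of some user $i\ne r$ ($x$ passes $a_i$); type 1b: the departure of some user $i\neq r$ is overtaken by the arrival of $r$; type 2a: the departure of some user $i$ overtakes the arrival of some user; type 2b: the departure of some user $i$ is overtaken by the arrival of some user $j\ne r$. *)

theory Defs
  imports "HOL-Analysis.Analysis"
begin

text \<open>
  Users are the elements of \<open>{1..N}\<close>; a vector in \<open>\<real>\<^sup>N\<close> is a function \<open>nat \<Rightarrow> real\<close> of which
  only the values on \<open>{1..N}\<close> matter.
\<close>

definition is_departure_vector ::
  "nat \<Rightarrow> real \<Rightarrow> real \<Rightarrow> (nat \<Rightarrow> real) \<Rightarrow> (nat \<Rightarrow> real) \<Rightarrow> bool" where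
  "is_departure_vector N \<alpha> \<beta> a d \<longleftrightarrow>
     (\<forall>i\<in>{1..N}. a i \<le> d i \<and>
        ((\<lambda>t. \<beta> - \<alpha> * ((\<Sum>j=1..N. indicator {a j..d j} t) - 1)) has_integral 1) {a i..d i})"

text \<open>Membership in \<open>extensional {1..N}\<close> fixes the irrelevant values outside \<open>{1..N}\<close>, so that
  uniqueness as a vector in \<open>\<real>\<^sup>N\<close> becomes uniqueness as a function.\<close>

definition departure_vector ::
  "nat \<Rightarrow> real \<Rightarrow> real \<Rightarrow> (nat \<Rightarrow> real) \<Rightarrow> nat \<Rightarrow> real" where
  "departure_vector N \<alpha> \<beta> a =
     (THE d. d \<in> extensional {1..N} \<and> is_departure_vector N \<alpha> \<beta> a d)"

definition arrival_path :: "nat \<Rightarrow> (nat \<Rightarrow> real) \<Rightarrow> nat \<Rightarrow> real \<Rightarrow> real" where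
  "arrival_path r a j x = (if j = r then x else a j)"

definition departure_path ::
  "nat \<Rightarrow> real \<Rightarrow> real \<Rightarrow> nat \<Rightarrow> (nat \<Rightarrow> real) \<Rightarrow> nat \<Rightarrow> real \<Rightarrow> real" where
  "departure_path N \<alpha> \<beta> r a i x = departure_vector N \<alpha> \<beta> (\<lambda>j. arrival_path r a j x) i"

definition overtakes_at :: "(real \<Rightarrow> real) \<Rightarrow> (real \<Rightarrow> real) \<Rightarrow> real \<Rightarrow> bool" where
  "overtakes_at f g x0 \<longleftrightarrow> (\<forall>\<^sub>F x in at_left x0. f x < g x) \<and> f x0 \<ge> g x0"

definition overtaken_by_at :: "(real \<Rightarrow> real) \<Rightarrow> (real \<Rightarrow> real) \<Rightarrow> real \<Rightarrow> bool" where
  "overtaken_by_at f g x0 \<longleftrightarrow> f x0 \<ge> g x0 \<and> (\<forall>\<^sub>F x in at_right x0. f x < g x)"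

datatype breakpoint_type = Type1a | Type1b | Type2a | Type2b

text \<open>
  A breakpoint is recorded as (type, user whose arrival or departure curve is the first one of
  the event, user whose arrival curve is the second one, position), so that distinct events are
  counted separately even when they occur at the same \<open>x0\<close>. The arrival and departure curves are
  defined for every real \<open>x\<close>; only events located in the closed interval \<open>{lo..hi}\<close> are counted,
  and at its end points the one-sided conditions look at the curves just outside it.
\<close>

definition breakpoints ::
  "nat \<Rightarrow> real \<Rightarrow> real \<Rightarrow> nat \<Rightarrow> (nat \<Rightarrow> real) \<Rightarrow> real \<Rightarrow> real
     \<Rightarrow> (breakpoint_type \<times> nat \<times> nat \<times> real) set" where
  "breakpoints N \<alpha> \<beta> r a lo hi =
     (let A = arrival_path r a; D = departure_path N \<alpha> \<beta> r a in
        {(Type1a, r, i, x0) | i x0. i \<in> {1..N} \<and> i \<noteq> r \<and> x0 \<in> {lo..hi} \<and>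
           overtakes_at (A r) (A i) x0}
      \<union> {(Type1b, i, r, x0) | i x0. i \<in> {1..N} \<and> i \<noteq> r \<and> x0 \<in> {lo..hi} \<and>
           overtaken_by_at (D i) (A r) x0}
      \<union> {(Type2a, i, j, x0) | i j x0. i \<in> {1..N} \<and> j \<in> {1..N} \<and> x0 \<in> {lo..hi} \<and>
           overtakes_at (D i) (A j) x0}
      \<union> {(Type2b, i, j, x0) | i j x0. i \<in> {1..N} \<and> j \<in> {1..N} \<and> j \<noteq> r \<and> x0 \<in> {lo..hi} \<and>
           overtaken_by_at (D i) (A j) x0})"

definition search_lower :: "nat \<Rightarrow> real \<Rightarrow> real \<Rightarrow> (nat \<Rightarrow> real) \<Rightarrow> real" where
  "search_lower N \<alpha> \<beta> dstar = dstar 1 - real N / (\<beta> - \<alpha> * (real N - 1))"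

definition search_upper :: "nat \<Rightarrow> real \<Rightarrow> real \<Rightarrow> (nat \<Rightarrow> real) \<Rightarrow> real" where
  "search_upper N \<alpha> \<beta> dstar = dstar N + real N / (\<beta> - \<alpha> * (real N - 1))"

end

(*
  The departure equations say that a primitive of the service speed grows by 1 between the
  arrival and the departure of each user. Since the users leave in order of arrival, the
  equation of user i turns into G(D_i) = h, where G is concave and strictly increasing and h is
  built from the arrivals and from max(A_i, D_j) for the users j that arrive earlier. Between two
  consecutive points of the set formed by the fixed arrivals a_j and by the points from which on a
  user leaves before r arrives, the order of arrivals and the set of users that r meets do not
  change, and h is convex as soon as these D_j are. By induction along the order of arrivals,
  every D_i is convex there, so D_i - A_j becomes nonnegative at most once, and likewise negative.
  There are at most 2 N such points, hence O(N) events for each pair (i, j).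
*)
theory Submission
  imports Defs
begin

section \<open>Positive parts, integrals of indicators, and convexity\<close>

lemma pos_part_diff_le:
  fixes s t c :: real
  assumes "s \<le> t"
  shows "max 0 (t - c) - max 0 (s - c) \<le> t - s"
  using assms by auto

text \<open>The value is the increment from \<open>s\<close> to \<open>t\<close> of the primitive
  \<open>max 0 (t - p) - max 0 (t - q)\<close>, so summing over users gives increments of one
  function of time.\<close>

lemma has_integral_indicator_Icc:
  fixes p q s t :: real
  assumes "p \<le> q" "s \<le> t"
  shows "(indicator {p..q} has_integral
     (max 0 (t - p) - max 0 (s - p)) - (max 0 (t - q) - max 0 (s - q))) {s..t}"
proof -
  have int: "{p..q} \<inter> {s..t} = {max p s..min q t}" by auto
  have "((\<lambda>x. 1::real) has_integral measure lborel {max p s..min q t}) {max p s..min q t}"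
    using has_integral_const_real[of "1::real" "max p s" "min q t"] by simp
  moreover have "measure lborel {max p s..min q t}
      = (max 0 (t - p) - max 0 (s - p)) - (max 0 (t - q) - max 0 (s - q))"
    using assms by (auto simp: content_real_if max_def min_def)
  ultimately have "((\<lambda>x. 1::real) has_integral
     (max 0 (t - p) - max 0 (s - p)) - (max 0 (t - q) - max 0 (s - q))) ({p..q} \<inter> {s..t})"
    unfolding int by simp
  then show ?thesis
    unfolding indicator_def of_bool_def
    by (subst has_integral_restrict_Int)
qed

text \<open>The inverse of an increasing concave function is increasing and convex, so composing it
  with a convex function stays convex. Comparing values of \<open>G\<close> avoids describing its
  range.\<close>

lemma convex_on_concave_inverse:
  fixes G f h :: "real \<Rightarrow> real"
  assumes "concave_on UNIV G" "strict_mono G" "convex_on J h" "\<And>x. x \<in> J \<Longrightarrow> G (f x) = h x"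
  shows "convex_on J f"
proof (rule convex_onI)
  show J: "convex J" using assms(3) by (rule convex_on_imp_convex)
  fix u x y :: real assume u: "0 < u" "u < 1" and xy: "x \<in> J" "y \<in> J"
  define w where "w = (1 - u) *\<^sub>R x + u *\<^sub>R y"
  have "w \<in> J"
    using convexD[OF J xy, of "1 - u" u] u by (simp add: w_def)
  then have "G (f w) = h w" by (rule assms(4))
  also have "\<dots> \<le> (1 - u) * h x + u * h y"
    using convex_onD[OF assms(3), of u x y] u xy by (simp add: w_def)
  also have "\<dots> = (1 - u) * G (f x) + u * G (f y)" using assms(4) xy by simp
  also have "\<dots> \<le> G ((1 - u) * f x + u * f y)"
    using concave_onD[OF assms(1), of u "f x" "f y"] u by simp
  finally show "f ((1 - u) *\<^sub>R x + u *\<^sub>R y) \<le> (1 - u) * f x + u * f y"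
    using strict_mono_less_eq[OF assms(2)] w_def by metis
qed

lemma convex_on_max:
  fixes f g :: "'a::real_vector \<Rightarrow> real"
  assumes "convex_on J f" "convex_on J g"
  shows "convex_on J (\<lambda>x. max (f x) (g x))"
proof (rule convex_onI)
  show "convex J" using assms(1) by (rule convex_on_imp_convex)
  fix u :: real and x y assume u: "0 < u" "u < 1" and xy: "x \<in> J" "y \<in> J"
  let ?w = "(1 - u) *\<^sub>R x + u *\<^sub>R y"
  have "f ?w \<le> (1 - u) * f x + u * f y" "g ?w \<le> (1 - u) * g x + u * g y"
    using convex_onD[OF assms(1), of u x y] convex_onD[OF assms(2), of u x y] u xy by simp_all
  moreover have "(1 - u) * f x \<le> (1 - u) * max (f x) (g x)" "(1 - u) * g x \<le> (1 - u) * max (f x) (g x)"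
      "u * f y \<le> u * max (f y) (g y)" "u * g y \<le> u * max (f y) (g y)"
    using u by (auto intro!: mult_left_mono)
  ultimately show "max (f ?w) (g ?w) \<le> (1 - u) * max (f x) (g x) + u * max (f y) (g y)"
    by linarith
qed

lemma convex_on_affine: "convex S \<Longrightarrow> convex_on S (\<lambda>x::real. p * x + q)"
  by (rule convex_onI) (simp_all add: algebra_simps)

lemma convex_on_cong:
  assumes "\<And>x. x \<in> S \<Longrightarrow> f x = g x"
  shows "convex_on S f \<longleftrightarrow> convex_on S g"
proof -
  have "convex_on S g" if "convex_on S f" "\<And>x. x \<in> S \<Longrightarrow> f x = g x" for f g
    unfolding convex_on_def
  proof (intro conjI ballI allI impI)
    show "convex S" using that(1) by (rule convex_on_imp_convex)
    fix x y and u v :: real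
    assume *: "x \<in> S" "y \<in> S" "0 \<le> u" "0 \<le> v" "u + v = 1"
    then have "u *\<^sub>R x + v *\<^sub>R y \<in> S" using \<open>convex S\<close> by (intro convexD)
    then show "g (u *\<^sub>R x + v *\<^sub>R y) \<le> u * g x + v * g y"
      using that * unfolding convex_on_def by metis
  qed
  then show ?thesis using assms by metis
qed

lemma convex_on_sum_fun:
  assumes "finite I" "convex S" "\<And>i. i \<in> I \<Longrightarrow> convex_on S (f i)"
  shows "convex_on S (\<lambda>x. \<Sum>i\<in>I. f i x)"
  using assms by (induction I rule: finite_induct) (auto intro: convex_on_add simp: convex_on_const)

section \<open>Counting events by sign changes of a convex difference\<close>

lemma card_le_if_separated:
  fixes E B :: "'a::linorder set"
  assumes B: "finite B" and sep: "\<And>x y. x \<in> E \<Longrightarrow> y \<in> E \<Longrightarrow> x < y \<Longrightarrow> \<exists>b\<in>B. x \<le> b \<and> b \<le> y"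
  shows "finite E \<and> card E \<le> 2 * card B + 1"
proof -
  \<comment> \<open>Adding the strict and the weak count numbers the gaps and the points of
    \<open>B\<close> consecutively from 0 to \<open>2 * card B\<close>. A separating
    \<open>b\<close> equal to \<open>x\<close> raises the strict count, any other one the weak
    count.\<close>
  define m where "m x = card {b\<in>B. b < x} + card {b\<in>B. b \<le> x}" for x
  have less: "m x < m y" if xy: "x \<in> E" "y \<in> E" "x < y" for x y
  proof -
    obtain b where b: "b \<in> B" "x \<le> b" "b \<le> y" using sep[OF xy] by blast
    have le: "card {b\<in>B. b < x} \<le> card {b\<in>B. b < y}" "card {b\<in>B. b \<le> x} \<le> card {b\<in>B. b \<le> y}"
      using B \<open>x < y\<close> by (auto intro!: card_mono)
    show ?thesis
    proof (cases "b = x")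
      case True
      then have "{b\<in>B. b < x} \<subset> {b\<in>B. b < y}" using b \<open>x < y\<close> by auto
      then have "card {b\<in>B. b < x} < card {b\<in>B. b < y}" using B by (intro psubset_card_mono) auto
      then show ?thesis using le by (simp add: m_def)
    next
      case False
      then have "b \<in> {b\<in>B. b \<le> y} - {b\<in>B. b \<le> x}" using b by auto
      moreover have "{b\<in>B. b \<le> x} \<subseteq> {b\<in>B. b \<le> y}" using \<open>x < y\<close> by auto
      ultimately have "{b\<in>B. b \<le> x} \<subset> {b\<in>B. b \<le> y}" by blast
      then have "card {b\<in>B. b \<le> x} < card {b\<in>B. b \<le> y}" using B by (intro psubset_card_mono) auto
      then show ?thesis using le by (simp add: m_def)
    qed
  qed
  have inj: "inj_on m E"
    by (rule inj_onI) (metis less less_irrefl linorder_less_linear)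
  have "m x \<le> 2 * card B" for x
  proof -
    have "card {b\<in>B. b < x} \<le> card B" "card {b\<in>B. b \<le> x} \<le> card B"
      using B by (auto intro!: card_mono)
    then show ?thesis by (simp add: m_def)
  qed
  then have sub: "m ` E \<subseteq> {..2 * card B}" by auto
  have "finite E" using finite_subset[OF sub] inj finite_imageD by blast
  moreover have "card E \<le> 2 * card B + 1"
    using card_mono[OF _ sub] card_image[OF inj] by simp
  ultimately show ?thesis ..
qed

lemma convex_on_neg_between:
  fixes h :: "real \<Rightarrow> real"
  assumes "convex_on {y..z} h" "h y < 0" "h z < 0" "y \<le> x" "x \<le> z"
  shows "h x < 0"
proof -
  have "x \<in> closed_segment y z" using assms by (simp add: closed_segment_eq_real_ivl)
  then obtain u where u: "0 \<le> u" "u \<le> 1" "x = (1 - u) *\<^sub>R y + u *\<^sub>R z"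
    by (auto simp: closed_segment_def)
  have "h x \<le> (1 - u) * h y + u * h z"
    using convex_onD[OF assms(1), of u y z] u assms by simp
  also have "\<dots> < 0"
  proof (cases "u = 0")
    case False
    then have "u * h z < 0" using u assms(3) by (simp add: mult_pos_neg)
    moreover have "(1 - u) * h y \<le> 0" using u assms(2) by (intro mult_nonneg_nonpos) auto
    ultimately show ?thesis by simp
  qed (use assms in simp)
  finally show ?thesis .
qed

text \<open>Two events of the same kind at \<open>x0 < x1\<close> make the difference negative, nonnegative and
  negative again, which is incompatible with convexity on an interval containing both.\<close>

lemma
  fixes f g :: "real \<Rightarrow> real"
  assumes B: "finite B"
    and conv: "\<And>y z. {y..z} \<inter> B = {} \<Longrightarrow> convex_on {y..z} (\<lambda>x. f x - g x)"
  shows overtakes_at_card: "finite {x. overtakes_at f g x} \<and> card {x. overtakes_at f g x} \<le> 2 * card B + 1"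
    and overtaken_by_at_card: "finite {x. overtaken_by_at f g x} \<and> card {x. overtaken_by_at f g x} \<le> 2 * card B + 1"
proof -
  \<comment> \<open>As \<open>B\<close> is finite, \<open>y\<close> can be so close to
    \<open>x\<close> that no point of \<open>B\<close> lies in \<open>[y, x)\<close>;
    \<open>x\<close> itself may belong to \<open>B\<close>. The parameter \<open>w\<close>
    prescribes a further lower bound.\<close>
  have left: "\<exists>y. y < x \<and> w < y \<and> f y < g y \<and> {y..<x} \<inter> B = {}"
    if ev: "\<forall>\<^sub>F x in at_left x. f x < g x" and "w < x" for x w
  proof -
    obtain c where c: "c < x" "\<And>y. c < y \<Longrightarrow> y < x \<Longrightarrow> f y < g y"
      using ev by (auto simp: eventually_at_left_field)
    define m where "m = Max (insert c (insert w {b\<in>B. b < x}))"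
    have m: "m < x" using B c that by (auto simp: m_def)
    have ub: "v \<le> m" if "v \<in> insert c (insert w {b\<in>B. b < x})" for v
      unfolding m_def using B that by (intro Max_ge) auto
    define y where "y = (m + x) / 2"
    have y: "m < y" "y < x" using m by (auto simp: y_def)
    have "{y..<x} \<inter> B = {}" using ub y by force
    then show ?thesis using y c(2)[of y] ub[of c] ub[of w] by (intro exI[of _ y]) auto
  qed
  have right: "\<exists>y. x < y \<and> y < w \<and> f y < g y \<and> {x<..y} \<inter> B = {}"
    if ev: "\<forall>\<^sub>F x in at_right x. f x < g x" and "x < w" for x w
  proof -
    obtain c where c: "x < c" "\<And>y. x < y \<Longrightarrow> y < c \<Longrightarrow> f y < g y"
      using ev by (auto simp: eventually_at_right_field)
    define m where "m = Min (insert c (insert w {b\<in>B. x < b}))"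
    have m: "x < m" using B c that by (auto simp: m_def)
    have lb: "m \<le> v" if "v \<in> insert c (insert w {b\<in>B. x < b})" for v
      unfolding m_def using B that by (intro Min_le) auto
    define y where "y = (m + x) / 2"
    have y: "x < y" "y < m" using m by (auto simp: y_def)
    have "{x<..y} \<inter> B = {}" using lb y by force
    then show ?thesis using y c(2)[of y] lb[of c] lb[of w] by (intro exI[of _ y]) auto
  qed
  have no: False if "f y < g y" "f z < g z" "y \<le> x" "x \<le> z" "g x \<le> f x" "{y..z} \<inter> B = {}" for x y z
    using convex_on_neg_between[OF conv[OF that(6)], of x] that by simp
  show "finite {x. overtakes_at f g x} \<and> card {x. overtakes_at f g x} \<le> 2 * card B + 1"
  proof (rule card_le_if_separated[OF B], rule ccontr)
    fix x0 x1 assume e: "x0 \<in> {x. overtakes_at f g x}" "x1 \<in> {x. overtakes_at f g x}" "x0 < x1"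
      and n: "\<not> (\<exists>b\<in>B. x0 \<le> b \<and> b \<le> x1)"
    obtain y where y: "y < x0" "f y < g y" "{y..<x0} \<inter> B = {}"
      using left[of x0 "x0 - 1"] e by (auto simp: overtakes_at_def)
    \<comment> \<open>Taking \<open>z\<close> right of \<open>x0\<close> makes \<open>x0\<close> the
      nonnegative point between \<open>y\<close> and \<open>z\<close>. Left of \<open>x0\<close> the
      choice of \<open>y\<close> avoids \<open>B\<close>, from \<open>x0\<close> on \<open>n\<close>
      does.\<close>
    obtain z where z: "x0 < z" "z < x1" "f z < g z"
      using left[of x1 x0] e by (auto simp: overtakes_at_def)
    have "{y..z} \<inter> B = {}" using y z n by force
    then show False using no[of y z x0] y z e by (auto simp: overtakes_at_def)
  qed
  show "finite {x. overtaken_by_at f g x} \<and> card {x. overtaken_by_at f g x} \<le> 2 * card B + 1"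
  proof (rule card_le_if_separated[OF B], rule ccontr)
    fix x0 x1 assume e: "x0 \<in> {x. overtaken_by_at f g x}" "x1 \<in> {x. overtaken_by_at f g x}" "x0 < x1"
      and n: "\<not> (\<exists>b\<in>B. x0 \<le> b \<and> b \<le> x1)"
    obtain y where y: "x0 < y" "y < x1" "f y < g y"
      using right[of x0 x1] e by (auto simp: overtaken_by_at_def)
    obtain z where z: "x1 < z" "f z < g z" "{x1<..z} \<inter> B = {}"
      using right[of x1 "x1 + 1"] e by (auto simp: overtaken_by_at_def)
    have "{y..z} \<inter> B = {}" using y z n by force
    then show False using no[of y z x1] y z e by (auto simp: overtaken_by_at_def)
  qed
qed

section \<open>Service speed and its primitive\<close>

locale slowdown_system =
  fixes N :: nat and \<alpha> \<beta> :: real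
  assumes alpha_pos: "0 < \<alpha>" and speed_pos: "0 < \<beta> - \<alpha> * (real N - 1)"
begin

text \<open>For \<open>L = {1..N}\<close> this is a primitive of the service speed; only its increments matter.
  A smaller \<open>L\<close> ignores the departures of the users outside \<open>L\<close>.\<close>

definition work :: "nat set \<Rightarrow> (nat \<Rightarrow> real) \<Rightarrow> (nat \<Rightarrow> real) \<Rightarrow> real \<Rightarrow> real" where
  "work L a d t = (\<alpha> + \<beta>) * t - \<alpha> * (\<Sum>j=1..N. max 0 (t - a j)) + \<alpha> * (\<Sum>j\<in>L. max 0 (t - d j))"

definition earlier :: "(nat \<Rightarrow> real) \<Rightarrow> nat \<Rightarrow> nat set" where
  "earlier a i = {j\<in>{1..N}. a j < a i}"

lemma finite_earlier [simp]: "finite (earlier a i)"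
  by (simp add: earlier_def)

lemma card_earlier_less: "j \<in> earlier a i \<Longrightarrow> card (earlier a j) < card (earlier a i)"
  by (rule psubset_card_mono) (auto simp: earlier_def)

text \<open>The slope of \<open>work\<close> is lowest when all \<open>N\<close> arrivals and no
  departures count: it is then \<open>\<alpha> + \<beta> - \<alpha> * N\<close>, the speed with
  everybody present.\<close>

lemma work_diff_ge:
  assumes "s \<le> t"
  shows "(\<beta> - \<alpha> * (real N - 1)) * (t - s) \<le> work L a d t - work L a d s"
proof -
  have "(\<Sum>j=1..N. max 0 (t - a j)) - (\<Sum>j=1..N. max 0 (s - a j))
      = (\<Sum>j=1..N. max 0 (t - a j) - max 0 (s - a j))" by (simp add: sum_subtractf)
  also have "\<dots> \<le> (\<Sum>j=1..N. t - s)"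
    by (intro sum_mono pos_part_diff_le assms)
  finally have 1: "(\<Sum>j=1..N. max 0 (t - a j)) - (\<Sum>j=1..N. max 0 (s - a j)) \<le> N * (t - s)" by simp
  have 2: "(\<Sum>j\<in>L. max 0 (s - d j)) \<le> (\<Sum>j\<in>L. max 0 (t - d j))"
    using assms by (intro sum_mono) auto
  show ?thesis
    using mult_left_mono[OF 1, of \<alpha>] mult_left_mono[OF 2, of \<alpha>] alpha_pos
    unfolding work_def by (simp only: algebra_simps) linarith
qed

lemma work_strict_mono: "strict_mono (work L a d)"
proof (rule strict_monoI)
  fix s t :: real assume "s < t"
  then show "work L a d s < work L a d t"
    using work_diff_ge[of s t L a d] mult_pos_pos[OF speed_pos, of "t - s"] by linarith
qed

lemmas work_less_iff = strict_mono_less[OF work_strict_mono]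
  and work_le_iff = strict_mono_less_eq[OF work_strict_mono]
  and work_eq_iff = strict_mono_eq[OF work_strict_mono]

lemma work_unit_solution: "\<exists>t. work L a d t = work L a d s + 1"
proof -
  \<comment> \<open>At the least possible speed one unit of work takes this long.\<close>
  let ?t = "s + 1 / (\<beta> - \<alpha> * (real N - 1))"
  have "1 \<le> work L a d ?t - work L a d s"
    using work_diff_ge[of s ?t L a d] speed_pos by simp
  moreover have "continuous_on {s..?t} (work L a d)"
    unfolding work_def by (intro continuous_intros)
  ultimately have "\<exists>t\<ge>s. t \<le> ?t \<and> work L a d t = work L a d s + 1"
    using speed_pos by (intro IVT') auto
  then show ?thesis by blast
qed

lemma speed_has_integral:
  assumes "\<And>j. j \<in> {1..N} \<Longrightarrow> a j \<le> d j" "s \<le> t"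
  shows "((\<lambda>t. \<beta> - \<alpha> * ((\<Sum>j=1..N. indicator {a j..d j} t) - 1)) has_integral
    (work {1..N} a d t - work {1..N} a d s)) {s..t}"
proof -
  have "((\<lambda>t. \<beta> - \<alpha> * ((\<Sum>j=1..N. indicator {a j..d j} t) - 1)) has_integral
     (\<beta> * (t - s) - \<alpha> * ((\<Sum>j=1..N. (max 0 (t - a j) - max 0 (s - a j)) - (max 0 (t - d j) - max 0 (s - d j))) - 1 * (t - s)))) {s..t}"
    using assms
    by (intro has_integral_diff has_integral_mult_right has_integral_sum has_integral_indicator_Icc
        has_integral_const_real[THEN has_integral_eq_rhs]) auto
  then show ?thesis
    by (rule has_integral_eq_rhs) (simp add: work_def sum_subtractf right_diff_distrib distrib_right)
qed

lemma is_departure_vector_iff_work: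
  "is_departure_vector N \<alpha> \<beta> a d \<longleftrightarrow>
     (\<forall>i\<in>{1..N}. a i \<le> d i \<and> work {1..N} a d (d i) = work {1..N} a d (a i) + 1)"
\<comment> \<open>The integral formula presupposes \<open>a j \<le> d j\<close> for every user;
  where this fails, both sides are false.\<close>
proof (cases "\<forall>i\<in>{1..N}. a i \<le> d i")
  case True
  have "((\<lambda>t. \<beta> - \<alpha> * ((\<Sum>j=1..N. indicator {a j..d j} t) - 1)) has_integral 1) {a i..d i} \<longleftrightarrow>
      work {1..N} a d (d i) = work {1..N} a d (a i) + 1" if "i \<in> {1..N}" for i
  proof -
    have I: "((\<lambda>t. \<beta> - \<alpha> * ((\<Sum>j=1..N. indicator {a j..d j} t) - 1)) has_integral
        (work {1..N} a d (d i) - work {1..N} a d (a i))) {a i..d i}"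
      using True that by (intro speed_has_integral) auto
    show ?thesis
    proof
      assume "((\<lambda>t. \<beta> - \<alpha> * ((\<Sum>j=1..N. indicator {a j..d j} t) - 1)) has_integral 1) {a i..d i}"
      from has_integral_unique[OF I this] show "work {1..N} a d (d i) = work {1..N} a d (a i) + 1"
        by linarith
    next
      assume "work {1..N} a d (d i) = work {1..N} a d (a i) + 1"
      then show "((\<lambda>t. \<beta> - \<alpha> * ((\<Sum>j=1..N. indicator {a j..d j} t) - 1)) has_integral 1) {a i..d i}"
        using I by simp
    qed
  qed
  then show ?thesis unfolding is_departure_vector_def using True by blast
next
  case False
  then show ?thesis unfolding is_departure_vector_def by blast
qed

lemma work_later_irrelevant:
  assumes "L \<subseteq> {1..N}" "L' \<subseteq> L" "\<And>j. j \<in> L - L' \<Longrightarrow> t \<le> d j"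
  shows "work L a d t = work L' a d t"
proof -
  have "(\<Sum>j\<in>L. max 0 (t - d j)) = (\<Sum>j\<in>L'. max 0 (t - d j))"
    using assms finite_subset[OF assms(1)] by (intro sum.mono_neutral_right) auto
  then show ?thesis by (simp add: work_def)
qed

section \<open>Departures as a recursion along the order of arrival\<close>

text \<open>The equation of \<open>i\<close> involves only departures of strictly earlier users, so
  \<open>card (earlier a i)\<close> is a well-founded measure even when arrivals coincide. That
  \<open>a i < d i\<close> follows from strict monotonicity of \<open>work\<close>.\<close>

definition solves_recursion :: "(nat \<Rightarrow> real) \<Rightarrow> (nat \<Rightarrow> real) \<Rightarrow> bool" where
  "solves_recursion a d \<longleftrightarrow>
     (\<forall>i\<in>{1..N}. work (earlier a i) a d (d i) = work (earlier a i) a d (a i) + 1)"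

lemma solves_recursion_less:
  assumes "solves_recursion a d" "i \<in> {1..N}"
  shows "a i < d i"
proof -
  have "work (earlier a i) a d (a i) < work (earlier a i) a d (d i)"
    using assms by (simp add: solves_recursion_def)
  then show ?thesis by (simp add: work_less_iff)
qed

text \<open>If \<open>i\<close> left before \<open>k\<close>, the users arriving from
  \<open>a k\<close> on and before \<open>a i\<close> would by induction leave at \<open>d k\<close>
  or later and be invisible until then. Both users would need one unit of the same increasing
  function, with \<open>i\<close> starting no earlier than \<open>k\<close>: a
  contradiction.\<close>

lemma solves_recursion_mono:
  assumes "solves_recursion a d" "k \<in> {1..N}" "i \<in> {1..N}" "a k \<le> a i"
  shows "d k \<le> d i"
  using assms(3,4)
proof (induction "card (earlier a i)" arbitrary: i rule: less_induct)
  case less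
  show ?case
  proof (rule ccontr)
    assume "\<not> d k \<le> d i"
    have eq: "work (earlier a i) a d t = work (earlier a k) a d t" if "t \<le> d k" for t
    proof (rule work_later_irrelevant)
      fix j assume j: "j \<in> earlier a i - earlier a k"
      then have "d k \<le> d j"
        by (intro less.hyps card_earlier_less) (auto simp: earlier_def)
      then show "t \<le> d j" using that by simp
    qed (use less.prems in \<open>auto simp: earlier_def\<close>)
    have "work (earlier a k) a d (d i) = work (earlier a k) a d (a i) + 1"
      using eq[of "d i"] eq[of "a i"] \<open>\<not> d k \<le> d i\<close> solves_recursion_less[OF assms(1) less.prems(1)]
        assms(1) less.prems(1) by (simp add: solves_recursion_def)
    moreover have "work (earlier a k) a d (d k) = work (earlier a k) a d (a k) + 1"
      using assms(1,2) by (simp add: solves_recursion_def)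
    moreover have "work (earlier a k) a d (a k) \<le> work (earlier a k) a d (a i)"
      using less.prems by (simp add: work_le_iff)
    ultimately show False using \<open>\<not> d k \<le> d i\<close> by (metis add_right_mono work_le_iff)
  qed
qed

text \<open>Up to time \<open>d i\<close> the functions \<open>work {1..N}\<close> and
  \<open>work (earlier a i)\<close> agree, since nobody outside \<open>earlier a i\<close> leaves
  before \<open>i\<close>.\<close>

lemma is_departure_vector_iff_recursion:
  "is_departure_vector N \<alpha> \<beta> a d \<longleftrightarrow> solves_recursion a d"
proof
  assume R: "solves_recursion a d"
  have "work {1..N} a d t = work (earlier a i) a d t" if "t \<le> d i" "i \<in> {1..N}" for i t
  proof (rule work_later_irrelevant)
    fix j assume "j \<in> {1..N} - earlier a i"
    then have "d i \<le> d j" using solves_recursion_mono[OF R, of i j] that by (auto simp: earlier_def)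
    then show "t \<le> d j" using that by simp
  qed (auto simp: earlier_def)
  then show "is_departure_vector N \<alpha> \<beta> a d"
    using R solves_recursion_less[OF R] unfolding is_departure_vector_iff_work solves_recursion_def
    by (metis less_imp_le order_refl)
next
  assume D: "is_departure_vector N \<alpha> \<beta> a d"
  then have le: "a i \<le> d i" and w: "work {1..N} a d (d i) = work {1..N} a d (a i) + 1"
    if "i \<in> {1..N}" for i
    using that by (auto simp: is_departure_vector_iff_work)
  have "work {1..N} a d t = work (earlier a i) a d t" if "t \<le> d i" "i \<in> {1..N}" for i t
  proof (rule work_later_irrelevant)
    fix j assume j: "j \<in> {1..N} - earlier a i"
    then have "a i \<le> a j" by (auto simp: earlier_def)
    \<comment> \<open>Here the order of departures comes from the full equations: each user's
      arrival and departure are one unit apart in the same increasing function.\<close>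
    then have "work {1..N} a d (a i) \<le> work {1..N} a d (a j)" by (simp add: work_le_iff)
    then have "work {1..N} a d (d i) \<le> work {1..N} a d (d j)" using w j that by simp
    then show "t \<le> d j" using that by (simp add: work_le_iff)
  qed (auto simp: earlier_def)
  then show "solves_recursion a d"
    using le w unfolding solves_recursion_def by (metis order_refl)
qed

text \<open>Up to time \<open>T\<close>, arrivals at or after \<open>T\<close> add nothing to
  \<open>work\<close>, and earlier users agree by induction. Equal arrivals give uniqueness; two
  positions of user \<open>r\<close> show that users leaving before \<open>r\<close> arrives are
  unaffected by a delay of \<open>r\<close>.\<close>

lemma departures_causal:
  assumes "solves_recursion a d" "solves_recursion a' d'"
    and same: "\<And>j. j \<in> {1..N} \<Longrightarrow> a j = a' j \<or> T \<le> a j \<and> T \<le> a' j"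
    and "i \<in> {1..N}" "d i < T"
  shows "d' i = d i"
  using assms(4,5)
proof (induction "card (earlier a i)" arbitrary: i rule: less_induct)
  case less
  have i: "a i < d i" using solves_recursion_less[OF assms(1)] less.prems by blast
  then have ai: "a' i = a i" using same[of i] less.prems by auto
  have E: "earlier a' i = earlier a i"
    using same i less.prems ai unfolding earlier_def by force
  have d: "d' j = d j" if "j \<in> earlier a i" for j
  proof (rule less.hyps)
    show "card (earlier a j) < card (earlier a i)" using that by (rule card_earlier_less)
    show "j \<in> {1..N}" using that by (simp add: earlier_def)
    show "d j < T"
      using solves_recursion_mono[OF assms(1), of j i] that less.prems by (auto simp: earlier_def)
  qed
  have w: "work (earlier a i) a' d' t = work (earlier a i) a d t" if "t \<le> T" for t
  proof -
    have "(\<Sum>j=1..N. max 0 (t - a' j)) = (\<Sum>j=1..N. max 0 (t - a j))"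
      using same that by (intro sum.cong refl) force
    then show ?thesis using d by (simp add: work_def)
  qed
  have "work (earlier a i) a' d' (d i) = work (earlier a i) a' d' (a i) + 1"
    using w[of "d i"] w[of "a i"] i less.prems assms(1) by (simp add: solves_recursion_def)
  also have "\<dots> = work (earlier a i) a' d' (d' i)"
  proof -
    have "work (earlier a' i) a' d' (d' i) = work (earlier a' i) a' d' (a' i) + 1"
      using assms(2) less.prems(1) unfolding solves_recursion_def by blast
    then show ?thesis unfolding E ai by (rule sym)
  qed
  finally show ?case by (simp add: work_eq_iff)
qed

lemma solves_recursion_exists: "\<exists>d. solves_recursion a d"
proof -
  let ?P = "\<lambda>d i t. work (earlier a i) a d t = work (earlier a i) a d (a i) + 1"
  have "\<exists>d. \<forall>i. ?P d i (d i)"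
  proof (rule dependent_wf_choice[of "Wellfounded.measure (\<lambda>i. card (earlier a i))"])
    fix f g :: "nat \<Rightarrow> real" and i t
    assume fg: "\<And>z. (z, i) \<in> Wellfounded.measure (\<lambda>i. card (earlier a i)) \<Longrightarrow> f z = g z"
    have "work (earlier a i) a f s = work (earlier a i) a g s" for s
      unfolding work_def using fg by (simp add: card_earlier_less)
    then show "?P f i t = ?P g i t" by simp
  qed (rule wf_measure, rule work_unit_solution)
  then show ?thesis by (auto simp: solves_recursion_def)
qed

lemma departure_vector_solves: "solves_recursion a (departure_vector N \<alpha> \<beta> a)"
proof -
  obtain d where d: "solves_recursion a d" using solves_recursion_exists by blast
  let ?d = "restrict d {1..N}"
  have "is_departure_vector N \<alpha> \<beta> a ?d"
  proof -
    have "work {1..N} a ?d t = work {1..N} a d t" for t by (simp add: work_def)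
    then show ?thesis
      using d unfolding is_departure_vector_iff_recursion[symmetric] is_departure_vector_iff_work by simp
  qed
  then have "?d \<in> extensional {1..N} \<and> is_departure_vector N \<alpha> \<beta> a ?d" by simp
  moreover have "e = ?d" if e: "e \<in> extensional {1..N} \<and> is_departure_vector N \<alpha> \<beta> a e" for e
  proof (rule extensionalityI[of _ "{1..N}"])
    fix i assume i: "i \<in> {1..N}"
    \<comment> \<open>Uniqueness is causality for equal arrivals, with any bound \<open>T\<close>
      above \<open>d i\<close>.\<close>
    show "e i = ?d i"
      using departures_causal[OF d, of a e "d i + 1" i] e i by (simp add: is_departure_vector_iff_recursion)
  qed (use e in auto)
  ultimately have "is_departure_vector N \<alpha> \<beta> a (departure_vector N \<alpha> \<beta> a)"
    unfolding departure_vector_def by (metis (mono_tags, lifting) theI')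
  then show ?thesis by (simp add: is_departure_vector_iff_recursion)
qed

text \<open>Every earlier \<open>d j\<close> is at most \<open>d i\<close>, so the positive parts of
  \<open>d i - d j\<close> are linear and the bare terms \<open>d j\<close> cancel. What remains is
  \<open>max (a i) (d j)\<close> with a positive coefficient, which preserves convexity.\<close>

lemma departure_balance:
  assumes "solves_recursion a d" "i \<in> {1..N}"
  shows "(\<alpha> + \<beta>) * d i - \<alpha> * (\<Sum>j=1..N. max 0 (d i - a j)) + \<alpha> * card (earlier a i) * d i
    = (\<alpha> + \<beta>) * a i - \<alpha> * (\<Sum>j=1..N. max 0 (a i - a j))
        + \<alpha> * (\<Sum>j\<in>earlier a i. max (a i) (d j)) + 1"
proof -
  have 1: "(\<Sum>j\<in>earlier a i. max 0 (d i - d j)) = (\<Sum>j\<in>earlier a i. d i - d j)"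
  proof (intro sum.cong refl)
    fix j assume "j \<in> earlier a i"
    then have "d j \<le> d i"
      using solves_recursion_mono[OF assms(1), of j i] assms(2) by (auto simp: earlier_def)
    then show "max 0 (d i - d j) = d i - d j" by simp
  qed
  have 2: "(\<Sum>j\<in>earlier a i. max 0 (a i - d j)) = (\<Sum>j\<in>earlier a i. max (a i) (d j) - d j)"
    by (intro sum.cong) auto
  have "work (earlier a i) a d (d i) = work (earlier a i) a d (a i) + 1"
    using assms by (simp add: solves_recursion_def)
  then show ?thesis unfolding work_def 1 2 by (simp add: sum_subtractf algebra_simps)
qed

end

section \<open>The system as the arrival of user \<open>r\<close> moves\<close>

locale coordinate_search = slowdown_system +
  fixes r :: nat and a :: "nat \<Rightarrow> real"
begin

abbreviation A :: "nat \<Rightarrow> real \<Rightarrow> real" where "A \<equiv> arrival_path r a"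
abbreviation D :: "nat \<Rightarrow> real \<Rightarrow> real" where "D \<equiv> departure_path N \<alpha> \<beta> r a"

lemma departure_path_solves: "solves_recursion (\<lambda>j. A j x) (\<lambda>i. D i x)"
  using departure_vector_solves[of "\<lambda>j. A j x"] by (simp add: departure_path_def[abs_def])

text \<open>The set under \<open>Inf\<close> is upward closed by \<open>departed_upward\<close>, so
  its infimum is the threshold from which on \<open>i\<close> leaves before \<open>r\<close>
  arrives. For \<open>i = r\<close> the set is empty, and the unspecified value of
  \<open>Inf\<close> only refines the partition.\<close>

definition special_points :: "real set" where
  "special_points = a ` ({1..N} - {r}) \<union> (\<lambda>i. Inf {x. D i x < x}) ` {1..N}"

lemma finite_special_points: "finite special_points"
  by (simp add: special_points_def)

lemma card_special_points: "card special_points \<le> 2 * N"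
proof -
  have "card (a ` ({1..N} - {r})) \<le> N"
    using card_image_le[of "{1..N} - {r}" a] card_mono[of "{1..N}" "{1..N} - {r}"] by simp
  moreover have "card ((\<lambda>i. Inf {x. D i x < x}) ` {1..N}) \<le> N"
    using card_image_le[of "{1..N}" "\<lambda>i. Inf {x. D i x < x}"] by simp
  ultimately show ?thesis
    unfolding special_points_def
    using card_Un_le[of "a ` ({1..N} - {r})" "(\<lambda>i. Inf {x. D i x < x}) ` {1..N}"] by linarith
qed

lemma arrival_order_const:
  assumes free: "{y..z} \<inter> special_points = {}" and x: "x \<in> {y..z}" "x' \<in> {y..z}"
    and "i \<in> {1..N}" "j \<in> {1..N}"
  shows "A j x < A i x \<longleftrightarrow> A j x' < A i x'"
proof -
  have "a k < y \<or> z < a k" if "k \<in> {1..N}" "k \<noteq> r" for k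
  proof -
    have "a k \<in> special_points" using that by (simp add: special_points_def)
    then have "a k \<notin> {y..z}" using free by blast
    then show ?thesis by auto
  qed
  from this[of i] this[of j] show ?thesis
    using assms(4,5) x by (auto simp: arrival_path_def)
qed

text \<open>Delaying an arrival of \<open>r\<close> at \<open>x\<close> cannot affect a departure
  before \<open>x\<close>, so \<open>D i\<close> keeps its value.\<close>

lemma departed_upward:
  assumes "i \<in> {1..N}" "D i x < x" "x < x'"
  shows "D i x' < x'"
proof -
  have "D i x' = D i x"
    by (rule departures_causal[OF departure_path_solves departure_path_solves, where T = x])
       (use assms in \<open>auto simp: arrival_path_def\<close>)
  then show ?thesis using assms by simp
qed

lemma departed_const:
  assumes free: "{y..z} \<inter> special_points = {}" and x: "x \<in> {y..z}" "x' \<in> {y..z}"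
    and i: "i \<in> {1..N}" and "D i x < x"
  shows "D i x' < x'"
proof (rule ccontr)
  assume n: "\<not> D i x' < x'"
  \<comment> \<open>Upward closure makes \<open>x'\<close> a lower bound of the set, so the infimum
    falls between \<open>x'\<close> and \<open>x\<close>, inside the free interval.\<close>
  have low: "x' \<le> t" if "t \<in> {x. D i x < x}" for t
    using departed_upward[OF i, of t x'] that n by (cases "t < x'") auto
  have "x' \<le> Inf {x. D i x < x}"
    using low assms(5) by (intro cInf_greatest) auto
  moreover have "Inf {x. D i x < x} \<le> x"
    using low assms(5) by (intro cInf_lower bdd_belowI) auto
  ultimately have "Inf {x. D i x < x} \<in> {y..z} \<inter> special_points"
    using x i by (auto simp: special_points_def)
  then show False using free by blast
qed

section \<open>Convexity of the curves between special points\<close>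

lemma convex_on_arrival_path: "convex S \<Longrightarrow> convex_on S (A i)"
  using convex_on_affine[of S 1 0] convex_on_affine[of S 0 "a i"]
  by (cases "i = r") (simp_all add: arrival_path_def[abs_def])

lemma convex_on_neg_arrival_path: "convex S \<Longrightarrow> convex_on S (\<lambda>x. - A i x)"
  using convex_on_affine[of S "- 1" 0] convex_on_affine[of S 0 "- a i"]
  by (cases "i = r") (simp_all add: arrival_path_def[abs_def])

text \<open>A negated positive part is only concave in general; with the order of \<open>A i\<close>
  and \<open>A j\<close> fixed it is affine or zero.\<close>

lemma convex_on_neg_pos_part_arrivals:
  assumes "{y..z} \<inter> special_points = {}" "i \<in> {1..N}" "j \<in> {1..N}"
  shows "convex_on {y..z} (\<lambda>x. - max 0 (A i x - A j x))"
proof (cases "\<exists>x\<in>{y..z}. A j x < A i x")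
  case True
  then have "A j x < A i x" if "x \<in> {y..z}" for x
    using arrival_order_const[OF assms(1)] that assms(2,3) by blast
  then have "- max 0 (A i x - A j x) = A j x + - A i x" if "x \<in> {y..z}" for x
    using that by (simp add: less_imp_le max_def)
  moreover have "convex_on {y..z} (\<lambda>x. A j x + - A i x)"
    by (intro convex_on_add convex_on_arrival_path convex_on_neg_arrival_path) simp_all
  ultimately show ?thesis by (subst convex_on_cong)
next
  case False
  then have "- max 0 (A i x - A j x) = 0" if "x \<in> {y..z}" for x
    using that by (simp add: not_less)
  then show ?thesis by (subst convex_on_cong[of _ _ "\<lambda>_. 0"]) (simp_all add: convex_on_const)
qed

text \<open>The left-hand side of the balance equation as a function of the departure time, with the
  contribution of user \<open>r\<close> absorbed into the coefficient \<open>c\<close>.\<close>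

definition load :: "real \<Rightarrow> real \<Rightarrow> real" where
  "load c t = c * t - \<alpha> * (\<Sum>j\<in>{1..N} - {r}. max 0 (t - a j))"

lemma concave_load: "concave_on UNIV (load c)"
proof -
  have "convex_on UNIV (\<lambda>t. max 0 (t - c))" for c :: real
    using convex_on_affine[of UNIV 1 "- c"] convex_on_affine[of UNIV 0 0]
    by (intro convex_on_max) simp_all
  then have "convex_on UNIV (\<lambda>t. \<alpha> * (\<Sum>j\<in>{1..N} - {r}. max 0 (t - a j)))"
    using alpha_pos by (intro convex_on_cmul convex_on_sum_fun) simp_all
  from convex_on_add[OF convex_on_affine[of UNIV "- c" 0] this]
  show ?thesis by (simp add: concave_on_def load_def)
qed

text \<open>The sum has \<open>N - 1\<close> terms of slope at most 1, so the slope of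
  \<open>load c\<close> is at least \<open>\<beta> - \<alpha> * (real N - 1)\<close>.\<close>

lemma strict_mono_load:
  assumes "r \<in> {1..N}" "\<beta> \<le> c"
  shows "strict_mono (load c)"
proof (rule strict_monoI)
  fix s t :: real assume st: "s < t"
  let ?U = "{1..N} - {r}"
  have "(\<Sum>j\<in>?U. max 0 (t - a j)) - (\<Sum>j\<in>?U. max 0 (s - a j))
      = (\<Sum>j\<in>?U. max 0 (t - a j) - max 0 (s - a j))" by (simp add: sum_subtractf)
  also have "\<dots> \<le> (\<Sum>j\<in>?U. t - s)"
    using st by (intro sum_mono pos_part_diff_le) simp
  also have "\<dots> = (real N - 1) * (t - s)" using assms(1) by (simp add: of_nat_diff)
  finally have "\<alpha> * ((\<Sum>j\<in>?U. max 0 (t - a j)) - (\<Sum>j\<in>?U. max 0 (s - a j))) \<le> \<alpha> * ((real N - 1) * (t - s))"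
    using alpha_pos by (intro mult_left_mono) auto
  moreover have "0 < (\<beta> - \<alpha> * (real N - 1)) * (t - s)" using st speed_pos by simp
  moreover have "\<beta> * (t - s) \<le> c * (t - s)" using st assms(2) by (intro mult_right_mono) auto
  ultimately show "load c s < load c t" by (simp add: load_def algebra_simps)
qed

lemma convex_on_departure_path:
  assumes r: "r \<in> {1..N}" and free: "{y..z} \<inter> special_points = {}" and "i \<in> {1..N}"
  shows "convex_on {y..z} (D i)"
  using assms(3)
\<comment> \<open>The order of arrival at \<open>y\<close> persists on the whole interval, so it can
  guide the induction for all \<open>x\<close> at once.\<close>
proof (induction "card (earlier (\<lambda>j. A j y) i)" arbitrary: i rule: less_induct)
  case less
  show ?case
  proof (cases "y \<le> z")
    case False
    then show ?thesis by (simp add: convex_on_def)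
  next
    case True
    define L where "L = earlier (\<lambda>j. A j y) i"
    have L: "earlier (\<lambda>j. A j x) i = L" if "x \<in> {y..z}" for x
      using arrival_order_const[OF free that, of y i] True less.prems
      by (auto simp: earlier_def L_def)
    have conv_earlier: "convex_on {y..z} (D j)" if "j \<in> L" for j
      using that less.hyps[of j] card_earlier_less[of j "\<lambda>j. A j y" i]
      by (auto simp: L_def earlier_def)
    \<comment> \<open>\<open>p\<close> records whether \<open>i\<close> leaves no earlier than
      \<open>r\<close> arrives. This is constant on the interval, so the positive part contributed
      by \<open>r\<close> becomes linear.\<close>
    define p where "p = (if y \<le> D i y then 1 else (0::real))"
    have p: "max 0 (D i x - x) = p * (D i x - x)" if "x \<in> {y..z}" for x
    proof -
      have "D i x < x \<longleftrightarrow> D i y < y"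
        using departed_const[OF free that, of y i] departed_const[OF free _ that, of y i] True less.prems
        by auto
      then show ?thesis by (auto simp: p_def)
    qed
    \<comment> \<open>In the balance equation \<open>- \<alpha> * p\<close> joins the coefficient of
      \<open>D i x\<close>, while the \<open>x\<close> part moves to the affine term
      \<open>- A r x\<close> in \<open>h\<close>. As \<open>p \<le> 1\<close>, still
      \<open>\<beta> \<le> c\<close>.\<close>
    define c where "c = \<alpha> + \<beta> + \<alpha> * card L - \<alpha> * p"
    define h where "h x = (\<alpha> + \<beta>) * A i x + \<alpha> * (\<Sum>j=1..N. - max 0 (A i x - A j x))
        + \<alpha> * (\<Sum>j\<in>L. max (A i x) (D j x)) + \<alpha> * p * (- A r x) + 1" for x
    have beta: "0 < \<beta>"
    proof -
      have "0 \<le> \<alpha> * (real N - 1)" using alpha_pos r by (intro mult_nonneg_nonneg) auto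
      then show ?thesis using speed_pos by linarith
    qed
    show ?thesis
    proof (rule convex_on_concave_inverse)
      show "concave_on UNIV (load c)" by (rule concave_load)
      show "strict_mono (load c)"
        using r alpha_pos by (intro strict_mono_load) (auto simp: c_def p_def)
      show "convex_on {y..z} h"
        unfolding h_def using alpha_pos beta less.prems conv_earlier
        by (intro convex_on_add convex_on_cmul convex_on_sum_fun convex_on_max
            convex_on_const[THEN iffD2] convex_on_arrival_path convex_on_neg_arrival_path convex_on_neg_pos_part_arrivals free)
          (auto simp: p_def L_def)
      fix x assume x: "x \<in> {y..z}"
      have split: "(\<Sum>j=1..N. max 0 (D i x - A j x))
          = max 0 (D i x - x) + (\<Sum>j\<in>{1..N} - {r}. max 0 (D i x - a j))"
        using r by (subst sum.remove[of _ r]) (auto simp: arrival_path_def intro!: sum.cong)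
      have neg: "(\<Sum>j=1..N. - max 0 (A i x - A j x)) = - (\<Sum>j=1..N. max 0 (A i x - A j x))"
        by (simp add: sum_negf)
      have Ar: "A r x = x" by (simp add: arrival_path_def)
      have collect: "(\<alpha> + \<beta> + \<alpha> * k - \<alpha> * p) * d - \<alpha> * S = (\<alpha> + \<beta>) * b + \<alpha> * (- T) + \<alpha> * U + \<alpha> * p * (- x) + 1"
        if "(\<alpha> + \<beta>) * d - \<alpha> * (p * (d - x) + S) + \<alpha> * k * d = (\<alpha> + \<beta>) * b - \<alpha> * T + \<alpha> * U + 1"
        for k d S b T U
        using that by (simp add: algebra_simps)
      show "load c (D i x) = h x"
        unfolding load_def c_def h_def Ar neg
        by (rule collect)
          (rule departure_balance[OF departure_path_solves less.prems, of x, unfolded L[OF x] split p[OF x]])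
    qed
  qed
qed

section \<open>Counting the breakpoints\<close>

lemma finite_card_breakpoints:
  assumes r: "r \<in> {1..N}"
  shows "finite (breakpoints N \<alpha> \<beta> r a lo hi) \<and>
    card (breakpoints N \<alpha> \<beta> r a lo hi) \<le> 4 * N ^ 2 * (4 * N + 1)"
proof -
  \<comment> \<open>This is \<open>2 * card B + 1\<close> for a set \<open>B\<close> of
    \<open>2 * N\<close> points.\<close>
  define M where "M = 4 * N + 1"
  have diff: "convex_on {y..z} (\<lambda>x. f x - A j x)" if "convex_on {y..z} f" for y z f j
    using convex_on_add[OF that convex_on_neg_arrival_path[of "{y..z}" j]] by simp
  have M: "2 * card special_points + 1 \<le> M"
    using card_special_points by (simp add: M_def)
  have e1: "finite {x. overtakes_at (A i) (A j) x} \<and> card {x. overtakes_at (A i) (A j) x} \<le> M" for i j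
    using overtakes_at_card[OF finite_special_points diff[OF convex_on_arrival_path[OF convex_real_interval(5)]], of i j] M le_trans by blast
  have e2: "finite {x. overtakes_at (D i) (A j) x} \<and> card {x. overtakes_at (D i) (A j) x} \<le> M" if "i \<in> {1..N}" for i j
    using overtakes_at_card[OF finite_special_points diff[OF convex_on_departure_path[OF r _ that]], of j] M le_trans by blast
  have e3: "finite {x. overtaken_by_at (D i) (A j) x} \<and> card {x. overtaken_by_at (D i) (A j) x} \<le> M" if "i \<in> {1..N}" for i j
    using overtaken_by_at_card[OF finite_special_points diff[OF convex_on_departure_path[OF r _ that]], of j] M le_trans by blast
  \<comment> \<open>Dropping the restrictions on position and users gives a superset with a uniform
    bound for every pair. In types 1a and 1b \<open>r\<close> takes the place of \<open>j\<close>,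
    hence the swapped entries in type 1a.\<close>
  define ev where "ev i j =
      (\<lambda>x. (Type1a, j, i, x)) ` {x. overtakes_at (A j) (A i) x}
    \<union> (\<lambda>x. (Type1b, i, j, x)) ` {x. overtaken_by_at (D i) (A j) x}
    \<union> (\<lambda>x. (Type2a, i, j, x)) ` {x. overtakes_at (D i) (A j) x}
    \<union> (\<lambda>x. (Type2b, i, j, x)) ` {x. overtaken_by_at (D i) (A j) x}" for i j
  have mem_ev:
    "(Type1a, k, l, x) \<in> ev i j \<longleftrightarrow> k = j \<and> l = i \<and> overtakes_at (A j) (A i) x"
    "(Type1b, k, l, x) \<in> ev i j \<longleftrightarrow> k = i \<and> l = j \<and> overtaken_by_at (D i) (A j) x"
    "(Type2a, k, l, x) \<in> ev i j \<longleftrightarrow> k = i \<and> l = j \<and> overtakes_at (D i) (A j) x"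
    "(Type2b, k, l, x) \<in> ev i j \<longleftrightarrow> k = i \<and> l = j \<and> overtaken_by_at (D i) (A j) x"
    for i j k l x
    by (auto simp: ev_def)
  have ev: "finite (ev i j)" "card (ev i j) \<le> 4 * M" if "i \<in> {1..N}" for i j
  proof -
    show "finite (ev i j)" using e1 e2[OF that] e3[OF that] by (simp add: ev_def)
    have c: "card (f ` S) \<le> M" if "finite S \<and> card S \<le> M"
      for f :: "real \<Rightarrow> breakpoint_type \<times> nat \<times> nat \<times> real" and S
      using that card_image_le le_trans by blast
    have U: "card (S \<union> T) \<le> m + n" if "card S \<le> m" "card T \<le> n"
      for S T :: "(breakpoint_type \<times> nat \<times> nat \<times> real) set" and m n
      using card_Un_le[of S T] that by linarith
    have "card (ev i j) \<le> M + M + M + M"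
      unfolding ev_def by (intro U c e1 e2 e3 that)
    then show "card (ev i j) \<le> 4 * M" by simp
  qed
  let ?X = "\<Union>i\<in>{1..N}. \<Union>j\<in>{1..N}. ev i j"
  have sub: "breakpoints N \<alpha> \<beta> r a lo hi \<subseteq> ?X"
  proof
    fix e assume "e \<in> breakpoints N \<alpha> \<beta> r a lo hi"
    then have "\<exists>i\<in>{1..N}. \<exists>j\<in>{1..N}. e \<in> ev i j"
      unfolding breakpoints_def Let_def using r by (auto simp: mem_ev)
    then show "e \<in> ?X" by blast
  qed
  have fin: "finite ?X" using ev by auto
  have "card ?X \<le> (\<Sum>i=1..N. card (\<Union>j\<in>{1..N}. ev i j))"
    by (rule card_UN_le) simp
  also have "\<dots> \<le> (\<Sum>i=1..N. \<Sum>j=1..N. card (ev i j))"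
    by (intro sum_mono card_UN_le) simp
  also have "\<dots> \<le> (\<Sum>i=1..N. \<Sum>j=1..N. 4 * M)"
    using ev by (intro sum_mono) auto
  also have "\<dots> = 4 * N ^ 2 * M" by (simp add: power2_eq_square)
  finally have "card ?X \<le> 4 * N ^ 2 * M" .
  then show ?thesis
    using finite_subset[OF sub fin] card_mono[OF fin sub] by (simp add: M_def)
qed

end

theorem proposition5p1:
  "\<exists>C::real. \<forall>(N::nat) (\<alpha>::real) (\<beta>::real) (dstar::nat \<Rightarrow> real) (r::nat) (a::nat \<Rightarrow> real).
     N \<ge> 1 \<longrightarrow> \<alpha> > 0 \<longrightarrow> \<beta> > 0 \<longrightarrow> real N < \<beta> / \<alpha> + 1 \<longrightarrow>
     mono_on {1..N} dstar \<longrightarrow>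
     r \<in> {1..N} \<longrightarrow>
     (\<forall>j\<in>{1..N} - {r}. a j \<in> {search_lower N \<alpha> \<beta> dstar..search_upper N \<alpha> \<beta> dstar}) \<longrightarrow>
     finite (breakpoints N \<alpha> \<beta> r a (search_lower N \<alpha> \<beta> dstar) (search_upper N \<alpha> \<beta> dstar)) \<and>
     real (card (breakpoints N \<alpha> \<beta> r a (search_lower N \<alpha> \<beta> dstar) (search_upper N \<alpha> \<beta> dstar)))
       \<le> C * real N ^ 3"
proof (intro exI[of _ 20] allI impI)
  fix N :: nat and \<alpha> \<beta> :: real and dstar :: "nat \<Rightarrow> real" and r :: nat and a :: "nat \<Rightarrow> real"
  assume "N \<ge> 1" and alpha: "\<alpha> > 0" and slow: "real N < \<beta> / \<alpha> + 1" and r: "r \<in> {1..N}"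
  \<comment> \<open>Clearing the denominator turns \<open>real N < \<beta> / \<alpha> + 1\<close>
    into \<open>speed_pos\<close>.\<close>
  have "real N - 1 < \<beta> / \<alpha>" using slow by linarith
  then have "(real N - 1) * \<alpha> < \<beta>" by (simp only: pos_less_divide_eq[OF alpha])
  then have "0 < \<beta> - \<alpha> * (real N - 1)" by (simp only: diff_gt_0_iff_gt mult.commute)
  with alpha interpret coordinate_search N \<alpha> \<beta> r a
    by (intro coordinate_search.intro slowdown_system.intro)
  let ?B = "breakpoints N \<alpha> \<beta> r a (search_lower N \<alpha> \<beta> dstar) (search_upper N \<alpha> \<beta> dstar)"
  have fin: "finite ?B" and le: "card ?B \<le> 4 * N ^ 2 * (4 * N + 1)"
    using finite_card_breakpoints[OF r] by blast+
  \<comment> \<open>The constant 20 is 4 event types times 5, from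
    \<open>4 * N + 1 \<le> 5 * N\<close>.\<close>
  have "4 * N ^ 2 * (4 * N + 1) \<le> 4 * N ^ 2 * (5 * N)" using \<open>N \<ge> 1\<close> by (intro mult_left_mono) simp_all
  also have "\<dots> = 20 * N ^ 3" by (simp add: power2_eq_square power3_eq_cube)
  finally have "card ?B \<le> 20 * N ^ 3" using le by simp
  then have "real (card ?B) \<le> real (20 * N ^ 3)" by (rule of_nat_mono)
  then show "finite ?B \<and> real (card ?B) \<le> 20 * real N ^ 3" using fin by simp
qed

end
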